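(* There exists a recursive universal subshift $X \subset S^{\mathbb{Z}}$ (for some finite alphabet $S$) which has only finitely many minimal subsystems.
   Context: For a finite alphabet $S$, give $S^{\mathbb{Z}}$ the product topology (with $S$ discrete) and the shift $\sigma(x)_i = x_{i+1}$. A subshift is a closed set $X \subset S^{\mathbb{Z}}$ with $\sigma(X)=X$. A subsystem (subshift) of $X$ is a subshift $Y \subset X$. A minimal subsystem is a nonempty subsystem whose only subshifts are $\emptyset$ and itself. The language $\mathcal{L}(X) \subset S^*$ is the set of all finite words occurring as contiguous subwords of points of $X$. $X$ is recursive if $\mathcal{L}(X)$ is a recursive (decidable) language. The model-checking problem of $X$ for finite-state automata is to decide, given a finite-state automaton recognizing a regular language $L \subset S^*$, whether $\mathcal{L}(X) \cap L \neq \emptyset$. $X$ is universal if this problem is $\Sigma^0_1$-complete (under many-one reductions). *)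

theory Defs
  imports "HOL-Analysis.Analysis" "HOL-Library.Nat_Bijection"
begin

datatype recf =
    Zero
  | Succ
  | Proj nat
  | Comp recf "recf list"
  | Prec recf recf
  | Mu recf

text \<open>
  \<open>rec_eval c xs y\<close>: the partial recursive function described by \<open>c\<close> is defined on the
  argument tuple \<open>xs\<close> and has value \<open>y\<close> there. Descriptions carry no arity: the
  number of arguments is the length of \<open>xs\<close>. The recursion variable and the variable
  of minimisation come first.
\<close>

inductive rec_eval :: "recf \<Rightarrow> nat list \<Rightarrow> nat \<Rightarrow> bool" where
  Zero: "rec_eval Zero xs 0"
| Succ: "rec_eval Succ [x] (Suc x)"
| Proj: "i < length xs \<Longrightarrow> rec_eval (Proj i) xs (xs ! i)"
| Comp: "list_all2 (\<lambda>g y. rec_eval g xs y) gs ys \<Longrightarrow> rec_eval f ys z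
    \<Longrightarrow> rec_eval (Comp f gs) xs z"
| Prec_0: "rec_eval f xs y \<Longrightarrow> rec_eval (Prec f g) (0 # xs) y"
| Prec_Suc: "rec_eval (Prec f g) (n # xs) y \<Longrightarrow> rec_eval g (n # y # xs) z
    \<Longrightarrow> rec_eval (Prec f g) (Suc n # xs) z"
| Mu: "rec_eval f (n # xs) 0 \<Longrightarrow> (\<And>m. m < n \<Longrightarrow> \<exists>y>0. rec_eval f (m # xs) y)
    \<Longrightarrow> rec_eval (Mu f) xs n"

definition computable :: "nat \<Rightarrow> (nat list \<Rightarrow> nat) \<Rightarrow> bool" where
  "computable k f \<longleftrightarrow> (\<exists>c. \<forall>xs. length xs = k \<longrightarrow> rec_eval c xs (f xs))"

definition decidable :: "nat \<Rightarrow> (nat list \<Rightarrow> bool) \<Rightarrow> bool" where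
  "decidable k R \<longleftrightarrow> computable k (\<lambda>xs. if R xs then 1 else 0)"

definition recursive_set :: "nat set \<Rightarrow> bool" where
  "recursive_set A \<longleftrightarrow> decidable 1 (\<lambda>xs. hd xs \<in> A)"

definition Sigma01 :: "nat set \<Rightarrow> bool" where
  "Sigma01 A \<longleftrightarrow> (\<exists>R. decidable 2 R \<and> A = {x. \<exists>y. R [x, y]})"

definition many_one_reducible :: "nat set \<Rightarrow> nat set \<Rightarrow> bool" where
  "many_one_reducible A B \<longleftrightarrow>
    (\<exists>f. computable 1 (\<lambda>xs. f (hd xs)) \<and> (\<forall>x. x \<in> A \<longleftrightarrow> f x \<in> B))"

definition Sigma01_complete :: "nat set \<Rightarrow> bool" where
  "Sigma01_complete B \<longleftrightarrow> Sigma01 B \<and> (\<forall>A. Sigma01 A \<longrightarrow> many_one_reducible A B)"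

definition shift :: "(int \<Rightarrow> 'a) \<Rightarrow> int \<Rightarrow> 'a" where
  "shift x = (\<lambda>i. x (i + 1))"

definition full_shift :: "'a set \<Rightarrow> (int \<Rightarrow> 'a) topology" where
  "full_shift S = product_topology (\<lambda>_. discrete_topology S) UNIV"

definition subshift :: "'a set \<Rightarrow> (int \<Rightarrow> 'a) set \<Rightarrow> bool" where
  "subshift S X \<longleftrightarrow> closedin (full_shift S) X \<and> shift ` X = X"

definition subsystem :: "'a set \<Rightarrow> (int \<Rightarrow> 'a) set \<Rightarrow> (int \<Rightarrow> 'a) set \<Rightarrow> bool" where
  "subsystem S X Y \<longleftrightarrow> subshift S Y \<and> Y \<subseteq> X"

definition minimal_subsystem :: "'a set \<Rightarrow> (int \<Rightarrow> 'a) set \<Rightarrow> (int \<Rightarrow> 'a) set \<Rightarrow> bool" where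
  "minimal_subsystem S X Y \<longleftrightarrow> Y \<noteq> {} \<and> subsystem S X Y \<and>
    (\<forall>Z. subsystem S Y Z \<longrightarrow> Z = {} \<or> Z = Y)"

definition language :: "(int \<Rightarrow> 'a) set \<Rightarrow> 'a list set" where
  "language X = {w. \<exists>x\<in>X. \<exists>i. w = map (\<lambda>j. x (i + int j)) [0..<length w]}"

text \<open>
  To speak of computability, letters are natural numbers, so that words can be coded by
  \<^const>\<open>list_encode\<close>; every finite alphabet can be renamed in this way.
\<close>

definition recursive_subshift :: "(int \<Rightarrow> nat) set \<Rightarrow> bool" where
  "recursive_subshift X \<longleftrightarrow> recursive_set (list_encode ` language X)"

text \<open>
  Nondeterministic automata with state set \<open>{..<n}\<close> for \<open>n = num_states\<close>. Transitions and
  final states are given as lists, whose order and repetitions are irrelevant, so that an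
  automaton is a finite object that can be coded by a number.
\<close>

record automaton =
  num_states :: nat
  start :: nat
  trans :: "(nat \<times> nat \<times> nat) list"
  final :: "nat list"

definition automaton_over :: "nat set \<Rightarrow> automaton \<Rightarrow> bool" where
  "automaton_over S A \<longleftrightarrow> start A < num_states A \<and>
    set (trans A) \<subseteq> {..<num_states A} \<times> S \<times> {..<num_states A} \<and>
    set (final A) \<subseteq> {..<num_states A}"

fun path :: "automaton \<Rightarrow> nat \<Rightarrow> nat list \<Rightarrow> nat \<Rightarrow> bool" where
  "path A p [] q \<longleftrightarrow> p = q"
| "path A p (a # w) q \<longleftrightarrow> (\<exists>r. (p, a, r) \<in> set (trans A) \<and> path A r w q)"

definition recognized :: "automaton \<Rightarrow> nat list set" where
  "recognized A = {w. \<exists>q\<in>set (final A). path A (start A) w q}"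

definition automaton_encode :: "automaton \<Rightarrow> nat" where
  "automaton_encode A = list_encode
    [num_states A, start A,
     list_encode (map (\<lambda>(p, a, q). list_encode [p, a, q]) (trans A)),
     list_encode (final A)]"

definition model_checking :: "nat set \<Rightarrow> (int \<Rightarrow> nat) set \<Rightarrow> nat set" where
  "model_checking S X =
    {automaton_encode A | A. automaton_over S A \<and> language X \<inter> recognized A \<noteq> {}}"

definition universal_subshift :: "nat set \<Rightarrow> (int \<Rightarrow> nat) set \<Rightarrow> bool" where
  "universal_subshift S X \<longleftrightarrow> Sigma01_complete (model_checking S X)"

end

theory Submission
  imports Defs "HOL-Library.More_List"
begin

text \<open>
  Let \<open>R\<close> be a decidable relation on natural numbers and let \<open>X\<close> consist of the nondecreasing
  sequences over \<open>{0..3}\<close> such that a point of the form \<open>\<dots>000 1^e 2^t 333\<dots>\<close> occurs only if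
  \<open>R e t\<close>. All other nondecreasing sequences are allowed: those that lack the letter 0 or the
  letter 3 contain no complete pair \<open>(e, t)\<close>, and a limit of points in which \<open>e\<close> or \<open>t\<close> grows
  without bound is of this kind, so \<open>X\<close> is closed.

  The language of \<open>X\<close> is decidable, because a word carries a constraint only if it contains both
  a 0 and a 3, and then it displays \<open>e\<close> and \<open>t\<close> in full; every other sorted word extends by
  constants on both sides. The automaton for \<open>0 1^e 2^* 3\<close>, however, asks whether \<open>R e t\<close>
  holds for some \<open>t\<close>. Every point of \<open>X\<close> is eventually constant, so each minimal subsystem
  contains, and hence is, one of the four constant points.

  It remains to choose \<open>R\<close> so that \<open>\<exists>t. R e t\<close> is complete. Here \<open>R e t\<close> says that \<open>t\<close> codes a
  formal derivation that the program and input coded by \<open>e\<close> yield the value 1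
  (\<open>halting_certificate\<close>): a list of claims ``program \<open>c\<close> on arguments \<open>x\<close> has value \<open>y\<close>'', each
  following from earlier ones by one evaluation rule. Checking a derivation only involves bounded
  search in a list, so it is decidable although evaluation is not
  (\<open>decidable_halting_certificate\<close>), and derivations exist exactly for the true claims
  (\<open>certificate_sound\<close>, \<open>certificate_complete\<close>). The properties of \<open>X\<close> are
  \<open>language_staircase\<close>, \<open>minimal_subsystem_staircase\<close>, \<open>recursive_staircase\<close> and
  \<open>universal_staircase\<close>.
\<close>

section \<open>Closure properties of the computable functions\<close>

text \<open>
  The variables of a computable expression are written \<open>arg i xs\<close>. A quantifier, recursion or
  minimisation puts its variable in front of the argument list, so that below it the outer
  variables have the form \<open>arg i (tl xs)\<close>. Unlike \<open>nth\<close>, \<open>arg\<close> commutes with \<open>tl\<close>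
  without a condition on the length. The rules collected in \<open>computable_intros\<close>
  then decompose any expression by resolution along its syntax.
\<close>

definition arg :: "nat \<Rightarrow> nat list \<Rightarrow> nat" where
  "arg i xs = hd (drop i xs)"

lemma arg_Cons_0 [simp]: "arg 0 (x # xs) = x"
  by (simp add: arg_def)

lemma arg_Cons_Suc [simp]: "arg (Suc i) (x # xs) = arg i xs"
  by (simp add: arg_def)

lemma arg_Cons_1 [simp]: "arg 1 (x # y # xs) = y"
  by (simp add: arg_def)

lemma arg_tl [simp]: "arg i (tl xs) = arg (Suc i) xs"
  by (simp add: arg_def drop_Suc)

lemma arg_nth: "i < length xs \<Longrightarrow> arg i xs = xs ! i"
  by (simp add: arg_def hd_drop_conv_nth)

named_theorems computable_intros

lemma computable_cong:
  "computable k f \<Longrightarrow> (\<And>xs. length xs = k \<Longrightarrow> f xs = g xs) \<Longrightarrow> computable k g"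
  unfolding computable_def by metis

lemma decidable_cong:
  "decidable k P \<Longrightarrow> (\<And>xs. length xs = k \<Longrightarrow> P xs \<longleftrightarrow> Q xs) \<Longrightarrow> decidable k Q"
  unfolding decidable_def by (erule computable_cong) simp

lemma computable_arg [computable_intros]: "i < k \<Longrightarrow> computable k (arg i)"
  unfolding computable_def by (metis arg_nth rec_eval.Proj)

lemma computable_arg_tl [computable_intros]:
  "Suc i < k \<Longrightarrow> computable k (\<lambda>xs. arg i (tl xs))"
  "Suc (Suc i) < k \<Longrightarrow> computable k (\<lambda>xs. arg i (tl (tl xs)))"
  "Suc (Suc (Suc i)) < k \<Longrightarrow> computable k (\<lambda>xs. arg i (tl (tl (tl xs))))"
  "Suc (Suc (Suc (Suc i))) < k \<Longrightarrow> computable k (\<lambda>xs. arg i (tl (tl (tl (tl xs)))))"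
  by (simp_all add: computable_arg)

lemma computable_comp:
  assumes f: "computable (length gs) f" and gs: "\<And>g. g \<in> set gs \<Longrightarrow> computable k g"
  shows "computable k (\<lambda>xs. f (map (\<lambda>g. g xs) gs))"
proof -
  obtain c where c: "\<And>ys. length ys = length gs \<Longrightarrow> rec_eval c ys (f ys)"
    using f unfolding computable_def by blast
  obtain d where d: "\<And>g xs. g \<in> set gs \<Longrightarrow> length xs = k \<Longrightarrow> rec_eval (d g) xs (g xs)"
    using gs unfolding computable_def by metis
  have "rec_eval (Comp c (map d gs)) xs (f (map (\<lambda>g. g xs) gs))" if "length xs = k" for xs
  proof (rule rec_eval.Comp)
    show "list_all2 (\<lambda>g y. rec_eval g xs y) (map d gs) (map (\<lambda>g. g xs) gs)"
      using d that by (simp add: list_all2_conv_all_nth)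
    show "rec_eval c (map (\<lambda>g. g xs) gs) (f (map (\<lambda>g. g xs) gs))"
      by (rule c) simp
  qed
  then show ?thesis
    unfolding computable_def by blast
qed

lemma computable_comp1:
  assumes "computable 1 (\<lambda>xs. f (arg 0 xs))" "computable k g"
  shows "computable k (\<lambda>xs. f (g xs))"
  using computable_comp[of "[g]" "\<lambda>xs. f (arg 0 xs)" k] assms by simp

lemma computable_comp2:
  assumes "computable 2 (\<lambda>xs. f (arg 0 xs) (arg 1 xs))" "computable k g" "computable k h"
  shows "computable k (\<lambda>xs. f (g xs) (h xs))"
  using computable_comp[of "[g, h]" "\<lambda>xs. f (arg 0 xs) (arg 1 xs)" k] assms
  by (auto simp: numeral_2_eq_2)

lemma decidable_comp1:
  assumes "decidable 1 (\<lambda>xs. P (arg 0 xs))" "computable k g"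
  shows "decidable k (\<lambda>xs. P (g xs))"
  using assms unfolding decidable_def by (rule computable_comp1[where f = "\<lambda>x. if P x then 1 else 0"])

lemma decidable_comp2:
  assumes "decidable 2 (\<lambda>xs. P (arg 0 xs) (arg 1 xs))" "computable k g" "computable k h"
  shows "decidable k (\<lambda>xs. P (g xs) (h xs))"
  using assms unfolding decidable_def
  by (rule computable_comp2[where f = "\<lambda>x y. if P x y then 1 else 0"])

lemma map_arg_upt: "length xs = k \<Longrightarrow> map (\<lambda>i. arg i xs) [j..<k] = drop j xs"
  by (rule nth_equalityI) (auto simp: arg_nth)

lemma computable_drop:
  assumes "computable k f"
  shows "computable (j + k) (\<lambda>xs. f (drop j xs))"
proof (rule computable_cong)
  show "computable (j + k) (\<lambda>xs. f (map (\<lambda>g. g xs) (map arg [j..<j + k])))"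
    using assms by (intro computable_comp) (auto simp: computable_arg)
qed (simp add: comp_def map_arg_upt)

lemma computable_weaken:
  "computable k f \<Longrightarrow> computable (Suc k) (\<lambda>xs. f (tl xs))"
  using computable_drop[of k f 1] by (simp add: drop_Suc)

text \<open>
  Substitution for the front variable. The \<open>j\<close> skipped arguments are variables that are bound
  around the substituted expression but do not occur in \<open>h\<close>.
\<close>

lemma computable_subst_drop:
  assumes h: "computable (Suc k) (\<lambda>xs. h (arg 0 xs) (tl xs))" and b: "computable (j + k) b"
  shows "computable (j + k) (\<lambda>xs. h (b xs) (drop j xs))"
proof (rule computable_cong)
  show "computable (j + k) (\<lambda>xs. h (arg 0 (map (\<lambda>g. g xs) (b # map arg [j..<j + k])))
      (tl (map (\<lambda>g. g xs) (b # map arg [j..<j + k]))))"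
    using h b by (intro computable_comp) (auto simp: computable_arg)
qed (simp add: comp_def map_arg_upt)

lemma computable_subst:
  assumes "computable (Suc k) (\<lambda>xs. h (arg 0 xs) (tl xs))" "computable k b"
  shows "computable k (\<lambda>xs. h (b xs) xs)"
  using computable_subst_drop[where j = 0 and h = h] assms by simp

lemma decidable_subst_tl:
  assumes "decidable (Suc k) (\<lambda>xs. P (arg 0 xs) (tl xs))" "computable (Suc k) b"
  shows "decidable (Suc k) (\<lambda>xs. P (b xs) (tl xs))"
  using computable_subst_drop[where j = 1 and h = "\<lambda>x xs. if P x xs then 1 else 0"] assms
  by (simp add: decidable_def drop_Suc)

lemma computable_Suc [computable_intros]: "computable k f \<Longrightarrow> computable k (\<lambda>xs. Suc (f xs))"
proof (rule computable_comp1[where f = Suc])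
  have "rec_eval Succ xs (Suc (arg 0 xs))" if "length xs = 1" for xs
    using that by (cases xs) (auto intro: rec_eval.Succ)
  then show "computable 1 (\<lambda>xs. Suc (arg 0 xs))"
    unfolding computable_def by blast
qed

lemma computable_const [computable_intros]: "computable k (\<lambda>xs. c)"
proof (induction c)
  case 0
  then show ?case
    unfolding computable_def by (blast intro: rec_eval.Zero)
qed (rule computable_Suc)

lemma computable_rec [computable_intros]:
  assumes f: "computable k f" and b: "computable k b"
    and g: "computable (Suc (Suc k)) (\<lambda>xs. g (arg 0 xs) (arg 1 xs) (tl (tl xs)))"
  shows "computable k (\<lambda>xs. rec_nat (f xs) (\<lambda>n y. g n y xs) (b xs))"
proof (rule computable_subst[where h = "\<lambda>n xs. rec_nat (f xs) (\<lambda>n y. g n y xs) n", OF _ b])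
  obtain c where c: "\<And>xs. length xs = k \<Longrightarrow> rec_eval c xs (f xs)"
    using f unfolding computable_def by blast
  obtain d where d: "\<And>xs. length xs = Suc (Suc k) \<Longrightarrow>
      rec_eval d xs (g (arg 0 xs) (arg 1 xs) (tl (tl xs)))"
    using g unfolding computable_def by blast
  have "rec_eval (Prec c d) (n # xs) (rec_nat (f xs) (\<lambda>n y. g n y xs) n)"
    if "length xs = k" for n xs
  proof (induction n)
    case (Suc n)
    then show ?case
      using rec_eval.Prec_Suc d[of "n # rec_nat (f xs) (\<lambda>n y. g n y xs) n # xs"] that by simp
  qed (use c that in \<open>simp add: rec_eval.Prec_0\<close>)
  then have "rec_eval (Prec c d) xs (rec_nat (f (tl xs)) (\<lambda>n y. g n y (tl xs)) (arg 0 xs))"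
    if "length xs = Suc k" for xs
    using that by (cases xs) auto
  then show "computable (Suc k) (\<lambda>xs. rec_nat (f (tl xs)) (\<lambda>n y. g n y (tl xs)) (arg 0 xs))"
    unfolding computable_def by blast
qed

text \<open>
  Primitive recursion on the truth value, with a step function that ignores the recursive result,
  is a case distinction. Negation and conjunction are instances.
\<close>

lemma computable_if [computable_intros]:
  assumes "decidable k P" "computable k f" "computable k g"
  shows "computable k (\<lambda>xs. if P xs then f xs else g xs)"
proof (rule computable_cong)
  show "computable k (\<lambda>xs. rec_nat (g xs) (\<lambda>_ _. f xs) (if P xs then 1 else 0))"
    using assms unfolding decidable_def by (intro computable_intros computable_weaken)
qed simp

lemma computable_add [computable_intros]:
  assumes "computable k f" "computable k g"
  shows "computable k (\<lambda>xs. f xs + g xs)"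
proof (rule computable_cong)
  show "computable k (\<lambda>xs. rec_nat (f xs) (\<lambda>_ y. Suc y) (g xs))"
    using assms by (intro computable_intros) simp_all
  have "rec_nat a (\<lambda>_ y. Suc y) b = a + b" for a b
    by (induction b) simp_all
  then show "rec_nat (f xs) (\<lambda>_ y. Suc y) (g xs) = f xs + g xs" for xs .
qed

lemma computable_pred:
  assumes "computable k f"
  shows "computable k (\<lambda>xs. f xs - Suc 0)"
proof (rule computable_cong)
  show "computable k (\<lambda>xs. rec_nat 0 (\<lambda>n _. n) (f xs))"
    using assms by (intro computable_intros) simp_all
  show "rec_nat 0 (\<lambda>n _. n) (f xs) = f xs - Suc 0" for xs
    by (cases "f xs") simp_all
qed

lemma computable_diff [computable_intros]:
  assumes "computable k f" "computable k g"
  shows "computable k (\<lambda>xs. f xs - g xs)"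
proof (rule computable_cong)
  show "computable k (\<lambda>xs. rec_nat (f xs) (\<lambda>_ y. y - Suc 0) (g xs))"
    using assms by (intro computable_intros computable_pred) simp_all
  have "rec_nat a (\<lambda>_ y. y - Suc 0) b = a - b" for a b :: nat
    by (induction b) simp_all
  then show "rec_nat (f xs) (\<lambda>_ y. y - Suc 0) (g xs) = f xs - g xs" for xs .
qed

lemma decidable_not [computable_intros]:
  assumes "decidable k P" shows "decidable k (\<lambda>xs. \<not> P xs)"
  unfolding decidable_def
  by (rule computable_cong[OF computable_if[OF assms computable_const[of k 0] computable_const[of k 1]]]) simp

lemma decidable_conj [computable_intros]:
  assumes "decidable k P" "decidable k Q" shows "decidable k (\<lambda>xs. P xs \<and> Q xs)"
  unfolding decidable_def
  by (rule computable_cong[OF computable_if[OF assms(1) assms(2)[unfolded decidable_def]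
        computable_const[of k 0]]]) simp

lemma decidable_disj [computable_intros]:
  assumes "decidable k P" "decidable k Q" shows "decidable k (\<lambda>xs. P xs \<or> Q xs)"
  by (rule decidable_cong[OF decidable_not[OF decidable_conj[OF assms[THEN decidable_not]]]]) simp

lemma decidable_imp [computable_intros]:
  assumes "decidable k P" "decidable k Q" shows "decidable k (\<lambda>xs. P xs \<longrightarrow> Q xs)"
  by (rule decidable_cong[OF decidable_disj[OF decidable_not[OF assms(1)] assms(2)]]) simp

lemma decidable_less [computable_intros]:
  assumes "computable k f" "computable k g"
  shows "decidable k (\<lambda>xs. f xs < g xs)"
  unfolding decidable_def
proof (rule computable_cong)
  show "computable k (\<lambda>xs. rec_nat 0 (\<lambda>_ _. 1) (g xs - f xs))"
    using assms by (intro computable_intros)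
  show "rec_nat 0 (\<lambda>_ _. 1) (g xs - f xs) = (if f xs < g xs then 1 else 0)" for xs
    by (cases "g xs - f xs") auto
qed

lemma decidable_le [computable_intros]:
  assumes "computable k f" "computable k g"
  shows "decidable k (\<lambda>xs. f xs \<le> g xs)"
  by (rule decidable_cong[OF decidable_not[OF decidable_less[OF assms(2,1)]]]) auto

lemma decidable_eq [computable_intros]:
  assumes "computable k f" "computable k g"
  shows "decidable k (\<lambda>xs. f xs = g xs)"
  by (rule decidable_cong[OF decidable_conj[OF decidable_le[OF assms] decidable_le[OF assms(2,1)]]]) auto

lemma decidable_ex_less [computable_intros]:
  assumes b: "computable k b" and P: "decidable (Suc k) (\<lambda>xs. P (arg 0 xs) (tl xs))"
  shows "decidable k (\<lambda>xs. \<exists>m<b xs. P m xs)"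
  unfolding decidable_def
proof (rule computable_cong)
  have "decidable (Suc (Suc k)) (\<lambda>xs. P (arg 0 xs) (tl (tl xs)))"
    using computable_subst_drop[where j = 2 and h = "\<lambda>x xs. if P x xs then 1 else 0"] P
      computable_arg[of 0 "Suc (Suc k)"]
    by (simp add: decidable_def drop_Suc numeral_2_eq_2)
  then show "computable k (\<lambda>xs. rec_nat 0 (\<lambda>m y. if P m xs \<or> y = 1 then 1 else 0) (b xs))"
    by (intro computable_intros b) simp_all
  have "rec_nat (0::nat) (\<lambda>m y. if P m xs \<or> y = 1 then 1 else 0) n = (if \<exists>m<n. P m xs then 1 else 0)" for n xs
    by (induction n) (auto simp: less_Suc_eq)
  then show "rec_nat (0::nat) (\<lambda>m y. if P m xs \<or> y = 1 then 1 else 0) (b xs) = (if \<exists>m<b xs. P m xs then 1 else 0)" for xs .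
qed

lemma decidable_all_less [computable_intros]:
  assumes b: "computable k b" and P: "decidable (Suc k) (\<lambda>xs. P (arg 0 xs) (tl xs))"
  shows "decidable k (\<lambda>xs. \<forall>m<b xs. P m xs)"
  by (rule decidable_cong[OF decidable_not[OF decidable_ex_less[OF b decidable_not[OF P]]]]) simp

text \<open>
  Minimisation searches for a zero, so it is applied to the negated test.
\<close>

lemma computable_Least [computable_intros]:
  assumes P: "decidable (Suc k) (\<lambda>xs. P (arg 0 xs) (tl xs))"
    and ex: "\<And>xs. length xs = k \<Longrightarrow> \<exists>n. P n xs"
  shows "computable k (\<lambda>xs. LEAST n. P n xs)"
proof -
  obtain c where c: "\<And>xs. length xs = Suc k \<Longrightarrow> rec_eval c xs (if \<not> P (arg 0 xs) (tl xs) then 1 else 0)"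
    using decidable_not[OF P] unfolding decidable_def computable_def by blast
  have c': "rec_eval c (n # xs) (if \<not> P n xs then 1 else 0)" if "length xs = k" for n xs
    using c[of "n # xs"] that by simp
  have "rec_eval (Mu c) xs (LEAST n. P n xs)" if xs: "length xs = k" for xs
  proof (rule rec_eval.Mu)
    show "rec_eval c ((LEAST n. P n xs) # xs) 0"
      using c'[OF xs, of "LEAST n. P n xs"] LeastI_ex[OF ex[OF xs]] by simp
    show "\<exists>y>0. rec_eval c (m # xs) y" if "m < (LEAST n. P n xs)" for m
      using c'[OF xs, of m] not_less_Least[OF that] by (intro exI[of _ 1]) simp
  qed
  then show ?thesis
    unfolding computable_def by blast
qed

lemma computable_prod_encode [computable_intros]:
  assumes f: "computable k f" and g: "computable k g"
  shows "computable k (\<lambda>xs. prod_encode (f xs, g xs))"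
proof -
  have "triangle n = rec_nat 0 (\<lambda>m y. y + Suc m) n" for n
    by (induction n) simp_all
  then show ?thesis
    unfolding prod_encode_def by (simp, intro computable_intros f g) simp_all
qed

text \<open>
  The components of a pair do not exceed its code, so a search bounded by the code
  inverts the pairing function.
\<close>

lemma computable_fst_prod_decode [computable_intros]:
  assumes f: "computable k f"
  shows "computable k (\<lambda>xs. fst (prod_decode (f xs)))"
proof (rule computable_comp1[OF _ f], rule computable_cong)
  show "computable 1 (\<lambda>xs. LEAST a. \<exists>b<Suc (arg 0 xs). prod_encode (a, b) = arg 0 xs)"
  proof (intro computable_intros)
    show "\<exists>a. \<exists>b<Suc (arg 0 xs). prod_encode (a, b) = arg 0 xs" for xs
      by (metis le_imp_less_Suc le_prod_encode_2 prod.collapse prod_decode_inverse)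
  qed simp_all
  show "(LEAST a. \<exists>b<Suc (arg 0 xs). prod_encode (a, b) = arg 0 xs) = fst (prod_decode (arg 0 xs))" for xs
  proof (rule Least_equality)
    show "\<exists>b<Suc (arg 0 xs). prod_encode (fst (prod_decode (arg 0 xs)), b) = arg 0 xs"
      by (metis le_imp_less_Suc le_prod_encode_2 prod.collapse prod_decode_inverse)
  qed (metis fst_conv order_refl prod_encode_inverse)
qed

lemma computable_snd_prod_decode [computable_intros]:
  assumes f: "computable k f"
  shows "computable k (\<lambda>xs. snd (prod_decode (f xs)))"
proof (rule computable_comp1[OF _ f], rule computable_cong)
  show "computable 1 (\<lambda>xs. LEAST b. \<exists>a<Suc (arg 0 xs). prod_encode (a, b) = arg 0 xs)"
  proof (intro computable_intros)
    show "\<exists>b. \<exists>a<Suc (arg 0 xs). prod_encode (a, b) = arg 0 xs" for xs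
      by (metis le_imp_less_Suc le_prod_encode_1 prod.collapse prod_decode_inverse)
  qed simp_all
  show "(LEAST b. \<exists>a<Suc (arg 0 xs). prod_encode (a, b) = arg 0 xs) = snd (prod_decode (arg 0 xs))" for xs
  proof (rule Least_equality)
    show "\<exists>a<Suc (arg 0 xs). prod_encode (a, snd (prod_decode (arg 0 xs))) = arg 0 xs"
      by (metis le_imp_less_Suc le_prod_encode_1 prod.collapse prod_decode_inverse)
  qed (metis snd_conv order_refl prod_encode_inverse)
qed

subsection \<open>Coded lists\<close>

text \<open>
  A nonempty list has the code \<open>Suc (prod_encode (head, tail))\<close>. Since \<open>prod_decode 0 = (0, 0)\<close>
  and subtraction truncates, the same decoding sends the code 0 of the empty list to the empty
  tail and the default head 0.
\<close>

definition tail_code :: "nat \<Rightarrow> nat" where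
  "tail_code n = snd (prod_decode (n - 1))"

definition drop_code :: "nat \<Rightarrow> nat \<Rightarrow> nat" where
  "drop_code n i = rec_nat n (\<lambda>_. tail_code) i"

lemma prod_decode_0: "prod_decode 0 = (0, 0)"
  using prod_encode_inverse[of "(0, 0)"] by (simp add: prod_encode_def)

lemma list_decode_tail_code: "list_decode (tail_code n) = tl (list_decode n)"
  by (cases n) (simp_all add: tail_code_def prod_decode_0 split: prod.split)

lemma list_decode_drop_code: "list_decode (drop_code n i) = drop i (list_decode n)"
  by (induction i) (simp_all add: drop_code_def list_decode_tail_code drop_Suc tl_drop)

lemma list_decode_eq_Nil: "list_decode n = [] \<longleftrightarrow> n = 0"
  by (metis list_decode.simps(1) list_decode_inverse)

lemma computable_drop_code [computable_intros]:
  "computable k f \<Longrightarrow> computable k g \<Longrightarrow> computable k (\<lambda>xs. drop_code (f xs) (g xs))"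
  unfolding drop_code_def tail_code_def by (intro computable_intros) simp_all

lemma computable_length [computable_intros]:
  assumes f: "computable k f"
  shows "computable k (\<lambda>xs. length (list_decode (f xs)))"
proof (rule computable_comp1[OF _ f], rule computable_cong)
  have eq: "drop_code n i = 0 \<longleftrightarrow> length (list_decode n) \<le> i" for n i
    by (metis list_decode_drop_code list_decode_eq_Nil drop_eq_Nil)
  show "computable 1 (\<lambda>xs. LEAST i. drop_code (arg 0 xs) i = 0)"
    by (intro computable_intros) (auto simp: eq)
  show "(LEAST i. drop_code (arg 0 xs) i = 0) = length (list_decode (arg 0 xs))" for xs
    by (rule Least_equality) (auto simp: eq)
qed

lemma computable_nth [computable_intros]:
  assumes "computable k f" "computable k g"
  shows "computable k (\<lambda>xs. nth_default 0 (list_decode (f xs)) (g xs))"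
proof -
  have "nth_default 0 (list_decode n) i = fst (prod_decode (drop_code n i - 1))" for n i
  proof -
    have "fst (prod_decode (m - 1)) = (if m = 0 then 0 else hd (list_decode m))" for m
      by (cases m) (simp_all add: prod_decode_0 split: prod.split)
    then show ?thesis
      using list_decode_drop_code[of n i] list_decode_eq_Nil[of "drop_code n i"]
      by (auto simp: nth_default_def hd_drop_conv_nth not_less)
  qed
  then show ?thesis
    by (simp, intro computable_intros assms)
qed

text \<open>
  Sets of the form \<open>set (take j L)\<close> occur below as the claims of a derivation that precede
  position \<open>j\<close>; quantification over them is bounded quantification over positions.
\<close>

lemma set_take_conv_nth_default:
  "set (take j L) = {nth_default 0 L i |i. i < j \<and> i < length L}"
  unfolding set_conv_nth by (intro Collect_cong ex_cong1) (auto simp: nth_default_nth)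

lemma decidable_bex_take [computable_intros]:
  assumes C: "computable k C" and j: "computable k j"
    and P: "decidable (Suc k) (\<lambda>xs. P (arg 0 xs) (tl xs))"
  shows "decidable k (\<lambda>xs. \<exists>e\<in>set (take (j xs) (list_decode (C xs))). P e xs)"
proof (rule decidable_cong)
  show "decidable k (\<lambda>xs. \<exists>i<j xs. i < length (list_decode (C xs)) \<and>
      P (nth_default 0 (list_decode (C xs)) i) xs)"
    by (intro computable_intros decidable_subst_tl[OF P] computable_weaken C j) simp_all
qed (auto simp: set_take_conv_nth_default)

lemma decidable_ball_take [computable_intros]:
  assumes "computable k C" "computable k j" "decidable (Suc k) (\<lambda>xs. P (arg 0 xs) (tl xs))"
  shows "decidable k (\<lambda>xs. \<forall>e\<in>set (take (j xs) (list_decode (C xs))). P e xs)"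
  by (rule decidable_cong[OF decidable_not[OF decidable_bex_take[OF assms(1,2) decidable_not[OF assms(3)]]]]) simp

lemma decidable_bex_set [computable_intros]:
  assumes "computable k C" "decidable (Suc k) (\<lambda>xs. P (arg 0 xs) (tl xs))"
  shows "decidable k (\<lambda>xs. \<exists>e\<in>set (list_decode (C xs)). P e xs)"
  using decidable_bex_take[OF assms(1) computable_length[OF assms(1)] assms(2)] by simp

lemma decidable_ball_set [computable_intros]:
  assumes "computable k C" "decidable (Suc k) (\<lambda>xs. P (arg 0 xs) (tl xs))"
  shows "decidable k (\<lambda>xs. \<forall>e\<in>set (list_decode (C xs)). P e xs)"
  using decidable_ball_take[OF assms(1) computable_length[OF assms(1)] assms(2)] by simp

lemma decidable_member_take [computable_intros]:
  assumes f: "computable k f" and "computable k C" "computable k j"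
  shows "decidable k (\<lambda>xs. f xs \<in> set (take (j xs) (list_decode (C xs))))"
proof (rule decidable_cong)
  show "decidable k (\<lambda>xs. \<exists>e\<in>set (take (j xs) (list_decode (C xs))). e = f xs)"
    by (intro computable_intros computable_weaken assms) simp_all
qed auto

lemma decidable_member [computable_intros]:
  assumes "computable k f" "computable k C"
  shows "decidable k (\<lambda>xs. f xs \<in> set (list_decode (C xs)))"
  using decidable_member_take[OF assms computable_length[OF assms(2)]] by simp

section \<open>A universal computably enumerable relation\<close>

inductive_cases rec_eval_ZeroE: "rec_eval Zero xs y"
inductive_cases rec_eval_SuccE: "rec_eval Succ xs y"
inductive_cases rec_eval_ProjE: "rec_eval (Proj i) xs y"
inductive_cases rec_eval_CompE: "rec_eval (Comp f gs) xs y"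
inductive_cases rec_eval_Prec_0E: "rec_eval (Prec f g) (0 # xs) y"
inductive_cases rec_eval_Prec_SucE: "rec_eval (Prec f g) (Suc n # xs) y"
inductive_cases rec_eval_MuE: "rec_eval (Mu f) xs y"

text \<open>
  A characteristic function with value 0 must not also have a derivation of the value 1.
\<close>

lemma rec_eval_deterministic: "rec_eval c xs y \<Longrightarrow> rec_eval c xs z \<Longrightarrow> y = z"
proof (induction arbitrary: z rule: rec_eval.induct)
  case (Comp xs gs ys f y)
  from Comp.prems obtain zs where zs: "list_all2 (\<lambda>g y. rec_eval g xs y) gs zs" "rec_eval f zs z"
    by (auto elim: rec_eval_CompE)
  have "ys = zs"
  proof (rule nth_equalityI)
    show "length ys = length zs"
      using Comp.IH(1) zs(1) by (auto simp: list_all2_lengthD[symmetric])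
  next
    fix i assume "i < length ys"
    then show "ys ! i = zs ! i"
      using Comp.IH(1) zs(1) by (auto simp: list_all2_conv_all_nth)
  qed
  then show ?case
    using Comp.IH(2) zs(2) by simp
next
  case (Mu f n xs)
  from Mu.prems have z: "rec_eval f (z # xs) 0" "\<And>m. m < z \<Longrightarrow> \<exists>y>0. rec_eval f (m # xs) y"
    by (auto elim: rec_eval_MuE)
  show ?case
  proof (rule linorder_cases[of n z])
    assume "n < z"
    then show ?thesis
      using z(2) Mu.IH(1) by fastforce
  next
    assume "z < n"
    then show ?thesis
      using z(1) Mu.IH(2) by fastforce
  qed
next
  case (Prec_Suc f g n xs y w)
  from Prec_Suc.prems obtain y' where "rec_eval (Prec f g) (n # xs) y'" "rec_eval g (n # y' # xs) z"
    by (auto elim: rec_eval_Prec_SucE)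
  then show ?case
    using Prec_Suc.IH by metis
qed (blast elim: rec_eval_ZeroE rec_eval_SuccE rec_eval_ProjE rec_eval_Prec_0E)+

fun recf_encode :: "recf \<Rightarrow> nat" where
  "recf_encode Zero = prod_encode (0, 0)"
| "recf_encode Succ = prod_encode (1, 0)"
| "recf_encode (Proj i) = prod_encode (2, i)"
| "recf_encode (Comp f gs) = prod_encode (3, list_encode (recf_encode f # map recf_encode gs))"
| "recf_encode (Prec f g) = prod_encode (4, prod_encode (recf_encode f, recf_encode g))"
| "recf_encode (Mu f) = prod_encode (5, recf_encode f)"

text \<open>
  The claim that the program with code \<open>c\<close>, applied to the argument list with code \<open>x\<close>, has
  value \<open>y\<close>.
\<close>

definition claim :: "nat \<Rightarrow> nat \<Rightarrow> nat \<Rightarrow> nat" where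
  "claim c x y = prod_encode (c, prod_encode (x, y))"

definition claim_prog :: "nat \<Rightarrow> nat" where
  "claim_prog e = fst (prod_decode e)"

definition claim_args :: "nat \<Rightarrow> nat" where
  "claim_args e = fst (prod_decode (snd (prod_decode e)))"

definition claim_value :: "nat \<Rightarrow> nat" where
  "claim_value e = snd (prod_decode (snd (prod_decode e)))"

lemma claim_simps [simp]:
  "claim_prog (claim c x y) = c" "claim_args (claim c x y) = x" "claim_value (claim c x y) = y"
  by (simp_all add: claim_def claim_prog_def claim_args_def claim_value_def)

definition cons_code :: "nat \<Rightarrow> nat \<Rightarrow> nat" where
  "cons_code n x = Suc (prod_encode (n, x))"

lemma list_decode_cons_code [simp]: "list_decode (cons_code n x) = n # list_decode x"
  by (simp add: cons_code_def)

lemma cons_code_list_encode [simp]: "cons_code n (list_encode xs) = list_encode (n # xs)"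
  by (simp add: cons_code_def)

text \<open>
  One disjunct for each evaluation rule, where the premises of the rule must be claims in \<open>E\<close>.
  The rules \<open>Comp\<close>, \<open>Prec_Suc\<close> and \<open>Mu\<close> have premises with values that do not occur in the
  conclusion. These are read off from a member \<open>e\<close> of \<open>E\<close>, so that all quantifiers are
  bounded when \<open>E\<close> is a finite list of claims.
\<close>

definition justified :: "nat set \<Rightarrow> nat \<Rightarrow> nat \<Rightarrow> nat \<Rightarrow> bool" where
  "justified E c x y \<longleftrightarrow>
    (let r = fst (prod_decode c); d = snd (prod_decode c); n = nth_default 0 (list_decode x) 0 in
      r = 0 \<and> y = 0 \<or>
      r = 1 \<and> length (list_decode x) = 1 \<and> y = Suc n \<or>
      r = 2 \<and> d < length (list_decode x) \<and> y = nth_default 0 (list_decode x) d \<or>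
      r = 3 \<and> (\<exists>e\<in>E. e = claim (nth_default 0 (list_decode d) 0) (claim_args e) y \<and>
        length (list_decode d) = Suc (length (list_decode (claim_args e))) \<and>
        (\<forall>i<length (list_decode (claim_args e)).
          claim (nth_default 0 (list_decode d) (Suc i)) x
            (nth_default 0 (list_decode (claim_args e)) i) \<in> E)) \<or>
      r = 4 \<and> 0 < length (list_decode x) \<and> n = 0 \<and>
        claim (fst (prod_decode d)) (drop_code x 1) y \<in> E \<or>
      r = 4 \<and> 0 < length (list_decode x) \<and> 0 < n \<and>
        (\<exists>e\<in>E. e = claim c (cons_code (n - 1) (drop_code x 1)) (claim_value e) \<and>
          claim (snd (prod_decode d))
            (cons_code (n - 1) (cons_code (claim_value e) (drop_code x 1))) y \<in> E) \<or>
      r = 5 \<and> claim d (cons_code y x) 0 \<in> E \<and>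
        (\<forall>m<y. \<exists>e\<in>E. e = claim d (cons_code m x) (claim_value e) \<and> 0 < claim_value e))"

definition certificate :: "nat list \<Rightarrow> bool" where
  "certificate C \<longleftrightarrow> (\<forall>j<length C. justified (set (take j C))
    (claim_prog (nth_default 0 C j)) (claim_args (nth_default 0 C j)) (claim_value (nth_default 0 C j)))"

text \<open>
  A claim about a number that is not the code of any program counts as true.
\<close>

definition true_claim :: "nat \<Rightarrow> bool" where
  "true_claim e \<longleftrightarrow> (\<forall>p. claim_prog e = recf_encode p \<longrightarrow>
    rec_eval p (list_decode (claim_args e)) (claim_value e))"

lemma list_decode_Cons: "0 < length (list_decode x) \<Longrightarrow>
   list_decode x = nth_default 0 (list_decode x) 0 # list_decode (drop_code x 1)"
  by (cases "list_decode x") (auto simp: list_decode_drop_code)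

text \<open>
  The tag of \<open>recf_encode p\<close> determines the constructor of \<open>p\<close> and thereby the only disjunct
  that can hold; the codes in that disjunct are then codes of the immediate subprograms.
\<close>

lemma justified_sound:
  assumes E: "\<And>e. e \<in> E \<Longrightarrow> true_claim e" and j: "justified E (recf_encode p) x y"
  shows "rec_eval p (list_decode x) y"
proof (cases p)
  case Zero
  then show ?thesis
    using j by (auto simp: justified_def intro: rec_eval.Zero)
next
  case Succ
  then show ?thesis
    using j by (cases "list_decode x") (auto simp: justified_def intro: rec_eval.Succ)
next
  case (Proj i)
  then show ?thesis
    using j by (auto simp: justified_def nth_default_nth intro: rec_eval.Proj)
next
  case (Comp f gs)
  then obtain e where e: "e \<in> E" "e = claim (recf_encode f) (claim_args e) y"
    "length gs = length (list_decode (claim_args e))"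
    and args: "\<And>i. i < length (list_decode (claim_args e)) \<Longrightarrow>
      claim (recf_encode (gs ! i)) x (list_decode (claim_args e) ! i) \<in> E"
    using j by (fastforce simp: justified_def nth_default_nth Let_def)
  show ?thesis
    unfolding Comp
  proof (rule rec_eval.Comp)
    show "list_all2 (\<lambda>g y. rec_eval g (list_decode x) y) gs (list_decode (claim_args e))"
      using E[OF args] e(3) by (auto simp: list_all2_conv_all_nth true_claim_def)
    show "rec_eval f (list_decode (claim_args e)) y"
      using E[OF e(1)] e(2) unfolding true_claim_def by (metis claim_simps)
  qed
next
  case (Prec f g)
  define n where "n = nth_default 0 (list_decode x) 0"
  have x: "0 < length (list_decode x)"
    using j Prec by (auto simp: justified_def Let_def)
  show ?thesis
  proof (cases n)
    case 0
    then have "claim (recf_encode f) (drop_code x 1) y \<in> E"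
      using j Prec by (auto simp: justified_def n_def Let_def)
    then have "rec_eval f (list_decode (drop_code x 1)) y"
      using E by (force simp: true_claim_def)
    then show ?thesis
      using list_decode_Cons[OF x] 0 Prec unfolding n_def by (metis rec_eval.Prec_0)
  next
    case (Suc m)
    then obtain e where e: "e \<in> E"
      "e = claim (recf_encode p) (cons_code m (drop_code x 1)) (claim_value e)"
      "claim (recf_encode g) (cons_code m (cons_code (claim_value e) (drop_code x 1))) y \<in> E"
      using j Prec by (auto simp: justified_def n_def Let_def)
    have "rec_eval (Prec f g) (m # list_decode (drop_code x 1)) (claim_value e)"
      using E[OF e(1)] e(2) Prec unfolding true_claim_def by (metis claim_simps list_decode_cons_code)
    moreover have "rec_eval g (m # claim_value e # list_decode (drop_code x 1)) y"
      using E[OF e(3)] by (simp add: true_claim_def)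
    ultimately show ?thesis
      using list_decode_Cons[OF x] Suc Prec unfolding n_def by (metis rec_eval.Prec_Suc)
  qed
next
  case (Mu f)
  then have 1: "claim (recf_encode f) (cons_code y x) 0 \<in> E"
    and 2: "\<And>m. m < y \<Longrightarrow> \<exists>e\<in>E. e = claim (recf_encode f) (cons_code m x) (claim_value e) \<and> 0 < claim_value e"
    using j by (auto simp: justified_def Let_def)
  show ?thesis
    unfolding Mu
  proof (rule rec_eval.Mu)
    show "rec_eval f (y # list_decode x) 0"
      using E[OF 1] by (simp add: true_claim_def)
    show "\<exists>z>0. rec_eval f (m # list_decode x) z" if "m < y" for m
      using 2[OF that] E unfolding true_claim_def by (metis claim_simps list_decode_cons_code)
  qed
qed

lemma certificate_sound:
  assumes "certificate C" "e \<in> set C"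
  shows "true_claim e"
proof -
  have "true_claim (C ! j)" if "j < length C" for j
    using that
  proof (induction j rule: less_induct)
    case (less j)
    have "true_claim e" if "e \<in> set (take j C)" for e
      using that less by (auto simp: in_set_conv_nth)
    moreover have "justified (set (take j C)) (claim_prog (C ! j)) (claim_args (C ! j)) (claim_value (C ! j))"
      using assms(1) less.prems by (auto simp: certificate_def nth_default_nth)
    ultimately show ?case
      by (metis justified_sound true_claim_def)
  qed
  then show ?thesis
    using assms(2) by (metis in_set_conv_nth)
qed

lemma justified_mono: "justified E c x y \<Longrightarrow> E \<subseteq> F \<Longrightarrow> justified F c x y"
  unfolding justified_def Let_def by (elim disjE) (simp_all, blast+)

text \<open>
  A claim of \<open>D\<close> has more predecessors in \<open>C @ D\<close> than in \<open>D\<close>, which does no harm because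
  justification is monotone.
\<close>

lemma certificate_append: "certificate C \<Longrightarrow> certificate D \<Longrightarrow> certificate (C @ D)"
  unfolding certificate_def
proof (intro allI impI)
  fix j
  assume C: "\<forall>j<length C. justified (set (take j C)) (claim_prog (nth_default 0 C j))
      (claim_args (nth_default 0 C j)) (claim_value (nth_default 0 C j))"
    and D: "\<forall>j<length D. justified (set (take j D)) (claim_prog (nth_default 0 D j))
      (claim_args (nth_default 0 D j)) (claim_value (nth_default 0 D j))"
    and j: "j < length (C @ D)"
  show "justified (set (take j (C @ D))) (claim_prog (nth_default 0 (C @ D) j))
      (claim_args (nth_default 0 (C @ D) j)) (claim_value (nth_default 0 (C @ D) j))"
  proof (cases "j < length C")
    case True
    then show ?thesis
      using C by (simp add: nth_default_append nth_default_nth)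
  next
    case False
    then have "justified (set (take (j - length C) D)) (claim_prog (nth_default 0 (C @ D) j))
      (claim_args (nth_default 0 (C @ D) j)) (claim_value (nth_default 0 (C @ D) j))"
      using D j by (auto simp: nth_default_append)
    then show ?thesis
      by (rule justified_mono) auto
  qed
qed

lemma certificate_snoc:
  assumes "certificate C" "justified (set C) c x y"
  shows "certificate (C @ [claim c x y])"
  using assms unfolding certificate_def by (auto simp: nth_default_append less_Suc_eq nth_default_nth)

definition certified :: "nat \<Rightarrow> bool" where
  "certified e \<longleftrightarrow> (\<exists>C. certificate C \<and> e \<in> set C)"

text \<open>
  Each premise comes with a certificate of its own. Concatenating these finitely many lists
  gives one certificate for all premises, to which the conclusion can be added.
\<close>

lemma certified_step:
  assumes "finite F" and F: "\<And>e. e \<in> F \<Longrightarrow> certified e" and "justified F c x y"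
  shows "certified (claim c x y)"
proof -
  have "\<exists>C. certificate C \<and> F \<subseteq> set C"
    using \<open>finite F\<close> F
  proof (induction F rule: finite_induct)
    case empty
    then show ?case
      by (intro exI[of _ "[]"]) (simp add: certificate_def)
  next
    case (insert e F)
    then obtain C D where "certificate C" "e \<in> set C" "certificate D" "F \<subseteq> set D"
      unfolding certified_def by (metis insertCI)
    then show ?case
      by (intro exI[of _ "C @ D"]) (auto simp: certificate_append)
  qed
  then obtain C where "certificate C" "F \<subseteq> set C"
    by blast
  then have "certificate (C @ [claim c x y])"
    using assms(3) by (auto intro: certificate_snoc justified_mono)
  then show ?thesis
    unfolding certified_def by (intro exI[of _ "C @ [claim c x y]"]) simp
qed

lemma drop_code_Cons [simp]: "drop_code (list_encode (n # xs)) 1 = list_encode xs"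
  by (metis drop0 drop_Suc_Cons list_decode_drop_code list_decode_inverse list_encode_inverse One_nat_def)

lemma certificate_complete:
  "rec_eval p xs y \<Longrightarrow> certified (claim (recf_encode p) (list_encode xs) y)"
proof (induction rule: rec_eval.induct)
  case (Zero xs)
  show ?case
    by (rule certified_step[of "{}"]) (auto simp: justified_def)
next
  case (Succ x)
  show ?case
    by (rule certified_step[of "{}"]) (auto simp: justified_def simp del: list_encode.simps)
next
  case (Proj i xs)
  then show ?case
    by (intro certified_step[of "{}"]) (auto simp: justified_def nth_default_nth)
next
  case (Comp xs gs ys f z)
  let ?F = "insert (claim (recf_encode f) (list_encode ys) z)
    ((\<lambda>i. claim (recf_encode (gs ! i)) (list_encode xs) (ys ! i)) ` {..<length ys})"
  show ?case
  proof (rule certified_step[of ?F])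
    show "certified e" if "e \<in> ?F" for e
      using that Comp.IH by (auto simp: list_all2_conv_all_nth)
    show "justified ?F (recf_encode (Comp f gs)) (list_encode xs) z"
      using list_all2_lengthD[OF Comp.IH(1)]
      by (simp add: justified_def nth_default_nth del: list_encode.simps)
  qed simp
next
  case (Prec_0 f xs y g)
  show ?case
    by (rule certified_step[of "{claim (recf_encode f) (list_encode xs) y}"])
      (use Prec_0 in \<open>auto simp: justified_def simp del: list_encode.simps One_nat_def\<close>)
next
  case (Prec_Suc f g n xs y z)
  show ?case
    by (rule certified_step[of "{claim (recf_encode (Prec f g)) (list_encode (n # xs)) y,
          claim (recf_encode g) (list_encode (n # y # xs)) z}"])
      (use Prec_Suc in \<open>auto simp: justified_def simp del: list_encode.simps One_nat_def\<close>)
next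
  case (Mu f n xs)
  then obtain v where v: "\<And>m. m < n \<Longrightarrow> 0 < v m"
    "\<And>m. m < n \<Longrightarrow> certified (claim (recf_encode f) (list_encode (m # xs)) (v m))"
    by metis
  let ?F = "insert (claim (recf_encode f) (list_encode (n # xs)) 0)
    ((\<lambda>m. claim (recf_encode f) (list_encode (m # xs)) (v m)) ` {..<n})"
  show ?case
  proof (rule certified_step[of ?F])
    show "certified e" if "e \<in> ?F" for e
      using that Mu.IH v by auto
    show "justified ?F (recf_encode (Mu f)) (list_encode xs) n"
      using v by (auto simp: justified_def Let_def simp del: list_encode.simps)
  qed simp
qed

text \<open>
  With \<open>e\<close> the code of a pair \<open>(c, x)\<close>, the list \<open>t\<close> derives that program \<open>c\<close> has
  value 1 on \<open>[x, y]\<close> for some \<open>y\<close>. Thus the existential quantifier over \<open>y\<close> in \<open>Sigma01\<close> and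
  the one over derivations are merged into a single one over \<open>t\<close>.
\<close>

definition halting_certificate :: "nat \<Rightarrow> nat \<Rightarrow> bool" where
  "halting_certificate e t \<longleftrightarrow> certificate (list_decode t) \<and>
    (\<exists>z\<in>set (list_decode t). claim_prog z = fst (prod_decode e) \<and>
      length (list_decode (claim_args z)) = 2 \<and>
      nth_default 0 (list_decode (claim_args z)) 0 = snd (prod_decode e) \<and> claim_value z = 1)"

lemma decidable_halting_certificate: "decidable 2 (\<lambda>xs. halting_certificate (arg 0 xs) (arg 1 xs))"
  unfolding halting_certificate_def certificate_def justified_def claim_def claim_prog_def
    claim_args_def claim_value_def cons_code_def Let_def
  by (intro computable_intros) simp_all

lemma halting_certificate_iff:
  "(\<exists>t. halting_certificate (prod_encode (recf_encode p, x)) t) \<longleftrightarrow> (\<exists>y. rec_eval p [x, y] 1)"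
proof
  assume "\<exists>t. halting_certificate (prod_encode (recf_encode p, x)) t"
  then obtain t z where "certificate (list_decode t)" "z \<in> set (list_decode t)"
    and z: "claim_prog z = recf_encode p" "length (list_decode (claim_args z)) = 2"
    "nth_default 0 (list_decode (claim_args z)) 0 = x" "claim_value z = 1"
    by (auto simp: halting_certificate_def)
  then have "true_claim z"
    by (blast intro: certificate_sound)
  moreover obtain y where "list_decode (claim_args z) = [x, y]"
    using z(2,3) by (auto simp: numeral_2_eq_2 length_Suc_conv)
  ultimately show "\<exists>y. rec_eval p [x, y] 1"
    using z unfolding true_claim_def by metis
next
  assume "\<exists>y. rec_eval p [x, y] 1"
  then obtain y C where "certificate C" "claim (recf_encode p) (list_encode [x, y]) 1 \<in> set C"
    using certificate_complete unfolding certified_def by blast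
  then show "\<exists>t. halting_certificate (prod_encode (recf_encode p, x)) t"
    by (intro exI[of _ "list_encode C"])
      (auto simp: halting_certificate_def simp del: list_encode.simps intro!: bexI)
qed

text \<open>
  Kleene's enumeration of the computably enumerable sets, with \<open>c\<close> as index of \<open>A\<close>.
\<close>

lemma halting_certificate_universal:
  assumes "Sigma01 A"
  obtains c where "\<And>x. x \<in> A \<longleftrightarrow> (\<exists>t. halting_certificate (prod_encode (c, x)) t)"
proof -
  from assms obtain R p where A: "A = {x. \<exists>y. R [x, y]}"
    and p: "\<And>xs. length xs = 2 \<Longrightarrow> rec_eval p xs (if R xs then 1 else 0)"
    unfolding Sigma01_def decidable_def computable_def by blast
  have "rec_eval p [x, y] 1 \<longleftrightarrow> R [x, y]" for x y
    using p[of "[x, y]"] rec_eval_deterministic[of p "[x, y]" 0 1] by (auto split: if_splits)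
  then show ?thesis
    using that[of "recf_encode p"] by (simp add: A halting_certificate_iff)
qed

section \<open>The staircase subshift of a relation\<close>

text \<open>
  The cylinders that fix finitely many coordinates form a base of the product topology: a set is
  closed if it contains every point that its members match on each finite set of coordinates.
\<close>

lemma closedin_full_shift:
  "closedin (full_shift S) X \<longleftrightarrow> (\<forall>x\<in>X. range x \<subseteq> S) \<and>
    (\<forall>x. range x \<subseteq> S \<and> (\<forall>J. finite J \<longrightarrow> (\<exists>y\<in>X. \<forall>i\<in>J. y i = x i)) \<longrightarrow> x \<in> X)"
    (is "_ \<longleftrightarrow> ?L \<and> ?R")
proof -
  have top: "x \<in> topspace (full_shift S) \<longleftrightarrow> range x \<subseteq> S" for x
    by (auto simp: full_shift_def PiE_def)
  have open_iff: "openin (full_shift S) U \<longleftrightarrow>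
      (\<forall>x\<in>U. range x \<subseteq> S \<and> (\<exists>J. finite J \<and> (\<forall>y. range y \<subseteq> S \<and> (\<forall>i\<in>J. y i = x i) \<longrightarrow> y \<in> U)))"
    for U
  proof
    assume U: "openin (full_shift S) U"
    show "\<forall>x\<in>U. range x \<subseteq> S \<and> (\<exists>J. finite J \<and> (\<forall>y. range y \<subseteq> S \<and> (\<forall>i\<in>J. y i = x i) \<longrightarrow> y \<in> U))"
    proof
      fix x assume "x \<in> U"
      then have x: "range x \<subseteq> S"
        using openin_subset[OF U] top by auto
      from U \<open>x \<in> U\<close> obtain V where V: "finite {i. V i \<noteq> S}" "x \<in> PiE UNIV V" "PiE UNIV V \<subseteq> U"
        unfolding full_shift_def openin_product_topology_alt by auto
      have "y \<in> U" if y: "range y \<subseteq> S" "\<forall>i\<in>{i. V i \<noteq> S}. y i = x i" for y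
      proof -
        have "y i \<in> V i" for i
          using y V(2) by (cases "V i = S") (auto simp: PiE_def)
        then show ?thesis
          using V(3) by (auto simp: PiE_def)
      qed
      then show "range x \<subseteq> S \<and> (\<exists>J. finite J \<and> (\<forall>y. range y \<subseteq> S \<and> (\<forall>i\<in>J. y i = x i) \<longrightarrow> y \<in> U))"
        using x V(1) by blast
    qed
  next
    assume U: "\<forall>x\<in>U. range x \<subseteq> S \<and> (\<exists>J. finite J \<and> (\<forall>y. range y \<subseteq> S \<and> (\<forall>i\<in>J. y i = x i) \<longrightarrow> y \<in> U))"
    show "openin (full_shift S) U"
      unfolding full_shift_def openin_product_topology_alt
    proof (intro ballI)
      fix x assume "x \<in> U"
      then obtain J where x: "range x \<subseteq> S" and J: "finite J"
        "\<And>y. range y \<subseteq> S \<Longrightarrow> (\<forall>i\<in>J. y i = x i) \<Longrightarrow> y \<in> U"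
        using bspec[OF U \<open>x \<in> U\<close>] by (elim conjE exE) blast
      define V where "V i = (if i \<in> J then {x i} else S)" for i
      have "finite {i \<in> UNIV. V i \<noteq> topspace (discrete_topology S)}"
        by (rule finite_subset[OF _ J(1)]) (auto simp: V_def split: if_splits)
      moreover have "PiE UNIV V \<subseteq> U"
      proof
        fix y assume y: "y \<in> PiE UNIV V"
        then have "y i \<in> V i" for i
          by (auto simp: PiE_def)
        then have V: "y i \<in> (if i \<in> J then {x i} else S)" for i
          by (simp only: V_def)
        then have "y i = x i" if "i \<in> J" for i
          using V[of i] that by simp
        moreover have "y i \<in> S" for i
          using V[of i] x by (cases "i \<in> J") auto
        ultimately show "y \<in> U"
          using J(2)[of y] by auto
      qed
      moreover have "\<forall>i\<in>UNIV. openin (discrete_topology S) (V i)" "x \<in> PiE UNIV V"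
        using x by (auto simp: V_def PiE_def)
      ultimately show "\<exists>V. finite {i \<in> UNIV. V i \<noteq> topspace (discrete_topology S)} \<and>
          (\<forall>i\<in>UNIV. openin (discrete_topology S) (V i)) \<and> x \<in> PiE UNIV V \<and> PiE UNIV V \<subseteq> U"
        by blast
    qed
  qed
  show ?thesis
  proof
    assume X: "closedin (full_shift S) X"
    then have "?L"
      using closedin_subset top by blast
    moreover have "?R"
    proof (intro allI impI, rule ccontr)
      fix x assume x: "range x \<subseteq> S \<and> (\<forall>J. finite J \<longrightarrow> (\<exists>y\<in>X. \<forall>i\<in>J. y i = x i))" "x \<notin> X"
      then have "x \<in> topspace (full_shift S) - X"
        using top by auto
      moreover have "openin (full_shift S) (topspace (full_shift S) - X)"
        using X by auto
      ultimately have "\<exists>J. finite J \<and>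
          (\<forall>y. range y \<subseteq> S \<and> (\<forall>i\<in>J. y i = x i) \<longrightarrow> y \<in> topspace (full_shift S) - X)"
        by (meson open_iff)
      then obtain J where J: "finite J"
        "\<forall>y. range y \<subseteq> S \<and> (\<forall>i\<in>J. y i = x i) \<longrightarrow> y \<in> topspace (full_shift S) - X"
        by (elim exE conjE)
      obtain y where y: "y \<in> X" "\<forall>i\<in>J. y i = x i"
        using x(1) J(1) by blast
      have "range y \<subseteq> S"
        using bspec[OF \<open>?L\<close> y(1)] by simp
      with J(2) y show False
        by blast
    qed
    ultimately show "?L \<and> ?R" ..
  next
    assume LR: "?L \<and> ?R"
    have "openin (full_shift S) (topspace (full_shift S) - X)"
      unfolding open_iff
    proof (intro ballI conjI)
      fix x assume x: "x \<in> topspace (full_shift S) - X"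
      then show "range x \<subseteq> S"
        using top by simp
      with x LR obtain J where J: "finite J" "\<not> (\<exists>y\<in>X. \<forall>i\<in>J. y i = x i)"
        by (meson DiffD2)
      then show "\<exists>J. finite J \<and>
          (\<forall>y. range y \<subseteq> S \<and> (\<forall>i\<in>J. y i = x i) \<longrightarrow> y \<in> topspace (full_shift S) - X)"
        by (intro exI[of _ J]) (auto simp: top)
    qed
    moreover have "X \<subseteq> topspace (full_shift S)"
      using conjunct1[OF LR] top by blast
    ultimately show "closedin (full_shift S) X"
      unfolding closedin_def by (intro conjI)
  qed
qed

lemma closedin_full_shiftD:
  assumes "closedin (full_shift S) X" "range x \<subseteq> S"
    and "\<And>J. finite J \<Longrightarrow> \<exists>y\<in>X. \<forall>i\<in>J. y i = x i"
  shows "x \<in> X"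
  using assms unfolding closedin_full_shift by meson

text \<open>
  For a monotone \<open>x\<close>, the inequalities say that \<open>x\<close> rises to at least 1, 2 and 3 directly after
  the positions \<open>i\<close>, \<open>j\<close> and \<open>k\<close>. So \<open>j - i\<close> is the number of letters 1 and \<open>k - j\<close> the
  number of letters 2. Steps may coincide, which covers the pairs with a zero entry.
\<close>

definition staircase :: "(nat \<Rightarrow> nat \<Rightarrow> bool) \<Rightarrow> (int \<Rightarrow> nat) set" where
  "staircase R = {x. (\<forall>i. x i \<le> 3) \<and> mono x \<and>
    (\<forall>i j k. x i < 1 \<and> 1 \<le> x (i + 1) \<and> x j < 2 \<and> 2 \<le> x (j + 1) \<and> x k < 3 \<and> 3 \<le> x (k + 1) \<longrightarrow>
      R (nat (j - i)) (nat (k - j)))}"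

lemma staircaseD:
  "x \<in> staircase R \<Longrightarrow> x i < 1 \<Longrightarrow> 1 \<le> x (i + 1) \<Longrightarrow> x j < 2 \<Longrightarrow> 2 \<le> x (j + 1) \<Longrightarrow>
    x k < 3 \<Longrightarrow> 3 \<le> x (k + 1) \<Longrightarrow> R (nat (j - i)) (nat (k - j))"
  unfolding staircase_def by blast

definition admissible :: "(nat \<Rightarrow> nat \<Rightarrow> bool) \<Rightarrow> nat list \<Rightarrow> bool" where
  "admissible R w \<longleftrightarrow> (\<forall>j<length w. w ! j \<le> 3 \<and> (\<forall>i<j. w ! i \<le> w ! j)) \<and>
    (\<forall>i<length w - 1. \<forall>j<length w - 1. \<forall>k<length w - 1.
      w ! i < 1 \<and> 1 \<le> w ! Suc i \<and> w ! j < 2 \<and> 2 \<le> w ! Suc j \<and> w ! k < 3 \<and> 3 \<le> w ! Suc k \<longrightarrow>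
      R (j - i) (k - j))"

text \<open>
  A nonempty admissible word becomes a point when its first and last letters are repeated forever: this
  creates no new step, so every constraint on the point is already a constraint on the word.
\<close>

lemma language_staircase: "language (staircase R) = {w. admissible R w}"
proof (intro set_eqI iffI)
  fix w assume "w \<in> language (staircase R)"
  then obtain x a where x: "x \<in> staircase R" and w: "w = map (\<lambda>j. x (a + int j)) [0..<length w]"
    unfolding language_def by blast
  have nth: "w ! j = x (a + int j)" if "j < length w" for j
    using that by (subst w) simp
  have nth_Suc: "w ! Suc j = x (a + int j + 1)" if "j < length w - 1" for j
    using that nth[of "Suc j"] by (simp add: add_ac)
  have "mono x"
    using x by (simp add: staircase_def)
  have "R (j - i) (k - j)"
    if "i < length w - 1" "j < length w - 1" "k < length w - 1" "w ! i < 1" "1 \<le> w ! Suc i"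
      "w ! j < 2" "2 \<le> w ! Suc j" "w ! k < 3" "3 \<le> w ! Suc k" for i j k
  proof -
    have "R (nat (a + int j - (a + int i))) (nat (a + int k - (a + int j)))"
      by (rule staircaseD[OF x]) (use that in \<open>simp_all add: nth nth_Suc add_ac\<close>)
    moreover have "nat (a + int m - (a + int l)) = m - l" for l m
      by arith
    ultimately show ?thesis
      by simp
  qed
  moreover have "w ! j \<le> 3 \<and> (\<forall>i<j. w ! i \<le> w ! j)" if "j < length w" for j
    using that x by (auto simp: staircase_def nth intro: monoD[OF \<open>mono x\<close>])
  ultimately show "w \<in> {w. admissible R w}"
    by (simp add: admissible_def)
next
  fix w assume "w \<in> {w. admissible R w}"
  then have w: "admissible R w"
    by simp
  show "w \<in> language (staircase R)"
  proof (cases "w = []")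
    case True
    have "(\<lambda>_. 0) \<in> staircase R"
      by (simp add: staircase_def mono_def)
    then show ?thesis
      using True unfolding language_def by auto
  next
    case False
    define pos where "pos z = nat (max 0 (min z (int (length w) - 1)))" for z
    define x where "x z = w ! pos z" for z
    have pos: "pos z < length w" for z
      using False by (auto simp: pos_def min_def max_def nat_less_iff)
    have le: "w ! i \<le> w ! j" if "i \<le> j" "j < length w" for i j
      using w that unfolding admissible_def by (cases "i = j") auto
    \<comment> \<open>Outside the word the extension is constant, so steps occur only inside.\<close>
    have step: "0 \<le> z \<and> z < int (length w) - 1" if "x z < x (z + 1)" for z
      using that False unfolding x_def pos_def
      by (cases "z < 0"; cases "z \<ge> int (length w) - 1") auto
    have "R (nat (j - i)) (nat (k - j))"
      if "x i < 1" "1 \<le> x (i + 1)" "x j < 2" "2 \<le> x (j + 1)" "x k < 3" "3 \<le> x (k + 1)" for i j k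
    proof -
      have nonneg: "0 \<le> i" "0 \<le> j" "0 \<le> k"
        and less: "i < int (length w) - 1" "j < int (length w) - 1" "k < int (length w) - 1"
        using that step[of i] step[of j] step[of k] by auto
      have "x z = w ! nat z" "x (z + 1) = w ! Suc (nat z)" if "0 \<le> z" "z < int (length w) - 1" for z
        using that by (auto simp: x_def pos_def min_def max_def nat_add_distrib)
      then have "R (nat j - nat i) (nat k - nat j)"
        using w that nonneg less unfolding admissible_def by (auto simp: nat_less_iff)
      then show ?thesis
        using nonneg by (simp add: nat_diff_distrib')
    qed
    moreover have "mono x"
      by (rule monoI) (auto simp: x_def intro!: le pos, auto simp: pos_def)
    moreover have "x z \<le> 3" for z
      using w pos by (auto simp: x_def admissible_def)
    ultimately have "x \<in> staircase R"
      by (simp add: staircase_def)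
    moreover have "w = map (\<lambda>j. x (0 + int j)) [0..<length w]"
      by (rule nth_equalityI) (auto simp: x_def pos_def)
    ultimately show ?thesis
      unfolding language_def by blast
  qed
qed

text \<open>
  The set is closed because each of its defining conditions involves at most six coordinates.
\<close>

lemma subshift_staircase: "subshift {0..3} (staircase R)"
  unfolding subshift_def
proof
  show "closedin (full_shift {0..3}) (staircase R)"
    unfolding closedin_full_shift
  proof (intro conjI allI impI)
    show "\<forall>x\<in>staircase R. range x \<subseteq> {0..3}"
      by (auto simp: staircase_def)
  next
    fix x :: "int \<Rightarrow> nat"
    assume x: "range x \<subseteq> {0..3} \<and> (\<forall>J. finite J \<longrightarrow> (\<exists>y\<in>staircase R. \<forall>i\<in>J. y i = x i))"
    have approx: "\<exists>y\<in>staircase R. \<forall>i\<in>J. y i = x i" if "finite J" for J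
      using x that by blast
    have "mono x"
    proof (rule monoI)
      fix i j :: int assume "i \<le> j"
      with approx[of "{i, j}"] show "x i \<le> x j"
        by (auto simp: staircase_def mono_def) metis
    qed
    moreover have "R (nat (j - i)) (nat (k - j))"
      if "x i < 1" "1 \<le> x (i + 1)" "x j < 2" "2 \<le> x (j + 1)" "x k < 3" "3 \<le> x (k + 1)" for i j k
    proof -
      obtain y where y: "y \<in> staircase R" "\<forall>z\<in>{i, i + 1, j, j + 1, k, k + 1}. y z = x z"
        using approx[of "{i, i + 1, j, j + 1, k, k + 1}"] by blast
      show ?thesis
        by (rule staircaseD[OF y(1)]) (use y(2) that in simp_all)
    qed
    moreover have "x i \<le> 3" for i
      using conjunct1[OF x] by (auto simp: image_subset_iff)
    ultimately show "x \<in> staircase R"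
      by (simp add: staircase_def)
  qed
next
  have shifted: "(\<lambda>i. x (i + a)) \<in> staircase R" if "x \<in> staircase R" for x a
  proof -
    have "R (nat (j - i)) (nat (k - j))"
      if "x (i + a) < 1" "1 \<le> x (i + 1 + a)" "x (j + a) < 2" "2 \<le> x (j + 1 + a)"
        "x (k + a) < 3" "3 \<le> x (k + 1 + a)" for i j k
    proof -
      have "R (nat ((j + a) - (i + a))) (nat ((k + a) - (j + a)))"
        by (rule staircaseD[OF \<open>x \<in> staircase R\<close>]) (use that in \<open>simp_all add: add_ac\<close>)
      then show ?thesis
        by simp
    qed
    then show ?thesis
      using that by (auto simp: staircase_def mono_def)
  qed
  show "shift ` staircase R = staircase R"
  proof (intro equalityI subsetI)
    fix x assume "x \<in> staircase R"
    then have "(\<lambda>i. x (i + (- 1))) \<in> staircase R"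
      by (rule shifted)
    moreover have "x = shift (\<lambda>i. x (i + (- 1)))"
      by (simp add: shift_def)
    ultimately show "x \<in> shift ` staircase R"
      by blast
  qed (auto simp: shift_def intro: shifted)
qed

text \<open>
  A bounded monotone sequence of integers is eventually constant, so its shifts converge to a
  constant point. This point lies in the closed set \<open>Y\<close>, and forms a subshift by itself.
\<close>

lemma minimal_subsystem_staircase:
  assumes "minimal_subsystem {0..3} (staircase R) Y"
  shows "\<exists>c\<le>3. Y = {\<lambda>_. c}"
proof -
  from assms obtain x where "x \<in> Y" and Y: "subshift {0..3} Y" "Y \<subseteq> staircase R"
    and minimal: "\<And>Z. subsystem {0..3} Y Z \<Longrightarrow> Z = {} \<or> Z = Y"
    unfolding minimal_subsystem_def subsystem_def by blast
  then have x: "\<And>i. x i \<le> 3" "mono x"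
    unfolding staircase_def by blast+
  then obtain m where m: "\<And>i. x i \<le> x m"
    using ex_has_greatest_nat[of "\<lambda>_. True" undefined x 4] by (auto simp: less_Suc_eq_le numeral_eq_Suc)
  \<comment> \<open>The maximum is attained, and kept from then on.\<close>
  define c where "c = x m"
  have const: "x i = c" if "m \<le> i" for i
    using m[of i] monoD[OF x(2) that] by (simp add: c_def)
  have iter: "(\<lambda>i. x (i + int n)) \<in> Y" for n
  proof (induction n)
    case (Suc n)
    then have "shift (\<lambda>i. x (i + int n)) \<in> Y"
      using Y(1) unfolding subshift_def by blast
    then show ?case
      by (simp add: shift_def add_ac)
  qed (simp add: \<open>x \<in> Y\<close>)
  have "c \<le> 3"
    using x by (simp add: c_def)
  have "(\<lambda>_. c) \<in> Y"
  proof -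
    have "\<exists>y\<in>Y. \<forall>i\<in>J. y i = c" if J: "finite J" for J
    proof -
      obtain l where "\<And>i. i \<in> J \<Longrightarrow> l \<le> i"
        using bdd_below_finite[OF J] unfolding bdd_below_def by blast
      then have "x (i + int (nat (m - l))) = c" if "i \<in> J" for i
        using that by (intro const) fastforce
      then show ?thesis
        by (intro bexI[OF _ iter[of "nat (m - l)"]] ballI)
    qed
    moreover have "closedin (full_shift {0..3}) Y"
      using Y(1) by (simp add: subshift_def)
    ultimately show ?thesis
      using \<open>c \<le> 3\<close> by (intro closedin_full_shiftD[of "{0..3}" Y "\<lambda>_. c"]) auto
  qed
  moreover have "subshift {0..3} {\<lambda>_. c}"
  proof -
    have "closedin (full_shift {0..3}) {\<lambda>_. c}"
      unfolding closedin_full_shift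
    proof (intro conjI allI impI)
      fix y :: "int \<Rightarrow> nat"
      assume y: "range y \<subseteq> {0..3} \<and> (\<forall>J. finite J \<longrightarrow> (\<exists>z\<in>{\<lambda>_. c}. \<forall>i\<in>J. z i = y i))"
      have "y i = c" for i
        using conjunct2[OF y, rule_format, of "{i}"] by simp
      then show "y \<in> {\<lambda>_. c}"
        by auto
    qed (use \<open>c \<le> 3\<close> in auto)
    then show ?thesis
      by (simp add: subshift_def shift_def)
  qed
  ultimately have "{\<lambda>_. c} = Y"
    using minimal[of "{\<lambda>_. c}"] by (auto simp: subsystem_def)
  then show ?thesis
    using \<open>c \<le> 3\<close> by blast
qed

lemma finite_minimal_subsystems_staircase:
  "finite {Y. minimal_subsystem {0..3} (staircase R) Y}"
proof (rule finite_subset)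
  show "{Y. minimal_subsystem {0..3} (staircase R) Y} \<subseteq> (\<lambda>c. {\<lambda>_. c}) ` {..3}"
    using minimal_subsystem_staircase by blast
qed simp

section \<open>Deciding the language\<close>

lemma admissible_nth_default:
  "admissible R w \<longleftrightarrow>
    (\<forall>j<length w. nth_default 0 w j \<le> 3 \<and> (\<forall>i<j. nth_default 0 w i \<le> nth_default 0 w j)) \<and>
    (\<forall>i<length w - 1. \<forall>j<length w - 1. \<forall>k<length w - 1.
      nth_default 0 w i < 1 \<and> 1 \<le> nth_default 0 w (Suc i) \<and>
      nth_default 0 w j < 2 \<and> 2 \<le> nth_default 0 w (Suc j) \<and>
      nth_default 0 w k < 3 \<and> 3 \<le> nth_default 0 w (Suc k) \<longrightarrow> R (j - i) (k - j))"
  by (simp add: admissible_def nth_default_nth)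

lemma decidable_admissible:
  assumes R: "decidable 2 (\<lambda>xs. R (arg 0 xs) (arg 1 xs))" and f: "computable k f"
  shows "decidable k (\<lambda>xs. admissible R (list_decode (f xs)))"
proof (rule decidable_comp1[OF _ f])
  show "decidable 1 (\<lambda>xs. admissible R (list_decode (arg 0 xs)))"
    unfolding admissible_nth_default
    by (intro computable_intros decidable_comp2[OF R]) simp_all
qed

lemma list_encode_image: "list_encode n \<in> list_encode ` A \<longleftrightarrow> n \<in> A"
  using inj_list_encode[of UNIV] by (rule inj_image_mem_iff)

lemma recursive_staircase:
  assumes R: "decidable 2 (\<lambda>xs. R (arg 0 xs) (arg 1 xs))"
  shows "recursive_subshift (staircase R)"
proof -
  have "hd xs \<in> list_encode ` language (staircase R) \<longleftrightarrow> admissible R (list_decode (arg 0 xs))" for xs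
    using list_encode_image[of "list_decode (hd xs)"] by (simp add: arg_def language_staircase)
  then show ?thesis
    unfolding recursive_subshift_def recursive_set_def
    using decidable_admissible[OF R computable_arg[of 0 1]] by simp
qed

section \<open>The model-checking problem\<close>

definition triple_code :: "nat \<Rightarrow> nat \<Rightarrow> nat \<Rightarrow> nat" where
  "triple_code p a q = cons_code p (cons_code a (cons_code q 0))"

lemma triple_code: "triple_code p a q = list_encode [p, a, q]"
  by (simp add: triple_code_def cons_code_def)

lemma path_iff_states:
  "path A p w q \<longleftrightarrow> (\<exists>ps. length ps = Suc (length w) \<and> ps ! 0 = p \<and> ps ! length w = q \<and>
    (\<forall>i<length w. (ps ! i, w ! i, ps ! Suc i) \<in> set (trans A)))"
proof (induction w arbitrary: p)
  case Nil
  show ?case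
    by (auto simp: length_Suc_conv intro!: exI[of _ "[p]"])
next
  case (Cons a w)
  show ?case
  proof
    assume "path A p (a # w) q"
    then obtain r ps where "(p, a, r) \<in> set (trans A)" "length ps = Suc (length w)" "ps ! 0 = r"
      "ps ! length w = q" "\<forall>i<length w. (ps ! i, w ! i, ps ! Suc i) \<in> set (trans A)"
      using Cons.IH by auto
    then show "\<exists>ps. length ps = Suc (length (a # w)) \<and> ps ! 0 = p \<and> ps ! length (a # w) = q \<and>
        (\<forall>i<length (a # w). (ps ! i, (a # w) ! i, ps ! Suc i) \<in> set (trans A))"
      by (intro exI[of _ "p # ps"]) (auto simp: less_Suc_eq_0_disj)
  next
    assume "\<exists>ps. length ps = Suc (length (a # w)) \<and> ps ! 0 = p \<and> ps ! length (a # w) = q \<and>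
        (\<forall>i<length (a # w). (ps ! i, (a # w) ! i, ps ! Suc i) \<in> set (trans A))"
    then obtain ps where ps: "length ps = Suc (length (a # w))" "ps ! 0 = p" "ps ! length (a # w) = q"
      "\<And>i. i < length (a # w) \<Longrightarrow> (ps ! i, (a # w) ! i, ps ! Suc i) \<in> set (trans A)"
      by blast
    have "path A (ps ! 1) w q"
      unfolding Cons.IH
      using ps(1,3) ps(4)[of "Suc _"] by (intro exI[of _ "tl ps"]) (auto simp: nth_tl)
    then show "path A p (a # w) q"
      using ps(2) ps(4)[of 0] by auto
  qed
qed

text \<open>
  Here \<open>x\<close> codes an automaton, \<open>u\<close> a word of the language and \<open>s\<close> the sequence of states of an
  accepting run on \<open>u\<close>: together \<open>u\<close> and \<open>s\<close> are the witness for \<open>Sigma01\<close>. That \<open>x\<close>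
  is a well-formed code has to be checked as well.
\<close>

definition accepting_run :: "(nat \<Rightarrow> nat \<Rightarrow> bool) \<Rightarrow> nat \<Rightarrow> nat \<Rightarrow> nat \<Rightarrow> bool" where
  "accepting_run R x u s \<longleftrightarrow>
    (let X = list_decode x; n = nth_default 0 X 0; T = list_decode (nth_default 0 X 2);
      F = list_decode (nth_default 0 X 3); w = list_decode u; ps = list_decode s in
      length X = 4 \<and> nth_default 0 X 1 < n \<and> (\<forall>f\<in>set F. f < n) \<and>
      (\<forall>t\<in>set T. length (list_decode t) = 3 \<and> nth_default 0 (list_decode t) 0 < n \<and>
        nth_default 0 (list_decode t) 1 \<le> 3 \<and> nth_default 0 (list_decode t) 2 < n) \<and>
      admissible R w \<and> length ps = Suc (length w) \<and> nth_default 0 ps 0 = nth_default 0 X 1 \<and>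
      (\<forall>i<length w. triple_code (nth_default 0 ps i) (nth_default 0 w i) (nth_default 0 ps (Suc i)) \<in> set T) \<and>
      nth_default 0 ps (length w) \<in> set F)"

lemma decidable_accepting_run:
  assumes R: "decidable 2 (\<lambda>xs. R (arg 0 xs) (arg 1 xs))"
    and "computable k f" "computable k g" "computable k h"
  shows "decidable k (\<lambda>xs. accepting_run R (f xs) (g xs) (h xs))"
proof -
  have "decidable 3 (\<lambda>xs. accepting_run R (arg 0 xs) (arg 1 xs) (arg 2 xs))"
    unfolding accepting_run_def Let_def triple_code_def cons_code_def
    by (intro computable_intros decidable_admissible[OF R]) simp_all
  then show ?thesis
    using computable_comp[of "[f, g, h]" "\<lambda>xs. if accepting_run R (arg 0 xs) (arg 1 xs) (arg 2 xs) then 1 else 0" k] assms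
    by (auto simp: decidable_def numeral_3_eq_3 numeral_2_eq_2)
qed

lemma accepting_run_sound:
  assumes "accepting_run R x u s"
  shows "x \<in> model_checking {0..3} (staircase R)"
proof -
  define T where "T = list_decode (nth_default 0 (list_decode x) 2)"
  define ps where "ps = list_decode s"
  define w where "w = list_decode u"
  define A where "A = \<lparr>num_states = nth_default 0 (list_decode x) 0, start = nth_default 0 (list_decode x) 1,
    trans = map (\<lambda>t. (nth_default 0 (list_decode t) 0, nth_default 0 (list_decode t) 1,
      nth_default 0 (list_decode t) 2)) T,
    final = list_decode (nth_default 0 (list_decode x) 3)\<rparr>"
  note run = assms[unfolded accepting_run_def Let_def, folded T_def ps_def w_def]
  have "list_encode [nth_default 0 L 0, nth_default 0 L 1, nth_default 0 L 2] = t"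
    if "L = list_decode t" "length L = 3" for t L
  proof -
    have "[nth_default 0 L 0, nth_default 0 L 1, nth_default 0 L 2] = list_decode t"
      using that by (auto simp: numeral_3_eq_3 numeral_2_eq_2 length_Suc_conv)
    then show ?thesis
      by (metis list_decode_inverse)
  qed
  then have "map (\<lambda>(p, a, q). list_encode [p, a, q]) (trans A) = T"
    using run by (auto simp: A_def comp_def intro!: map_idI simp del: list_encode.simps)
  moreover have "[nth_default 0 L 0, nth_default 0 L 1, nth_default 0 L 2, nth_default 0 L 3] = L"
    if "length L = 4" for L :: "nat list"
    using that by (auto simp: numeral_eq_Suc length_Suc_conv)
  ultimately have "automaton_encode A = x"
    using run unfolding automaton_encode_def
    by (simp add: A_def T_def del: list_encode.simps)
  moreover have "automaton_over {0..3} A"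
    using run unfolding automaton_over_def by (auto simp: A_def)
  moreover have "path A (start A) w (nth_default 0 ps (length w))"
    unfolding path_iff_states
  proof (intro exI[of _ ps] conjI allI impI)
    fix i assume "i < length w"
    then have "triple_code (ps ! i) (w ! i) (ps ! Suc i) \<in> set T"
      using run by (auto simp: nth_default_nth)
    then show "(ps ! i, w ! i, ps ! Suc i) \<in> set (trans A)"
      by (force simp: A_def triple_code numeral_2_eq_2 simp del: list_encode.simps)
  qed (use run in \<open>auto simp: A_def nth_default_nth\<close>)
  then have "w \<in> recognized A"
    using run unfolding recognized_def by (auto simp: A_def)
  moreover have "w \<in> language (staircase R)"
    using run by (simp add: language_staircase)
  ultimately show ?thesis
    unfolding model_checking_def by blast
qed

lemma accepting_run_complete:
  assumes "x \<in> model_checking {0..3} (staircase R)"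
  shows "\<exists>u s. accepting_run R x u s"
proof -
  from assms obtain A w where x: "x = automaton_encode A" and A: "automaton_over {0..3} A"
    and w: "admissible R w" "w \<in> recognized A"
    unfolding model_checking_def language_staircase by blast
  from w(2) obtain ps where ps: "length ps = Suc (length w)" "ps ! 0 = start A"
    "ps ! length w \<in> set (final A)" "\<forall>i<length w. (ps ! i, w ! i, ps ! Suc i) \<in> set (trans A)"
    unfolding recognized_def path_iff_states by blast
  have "accepting_run R x (list_encode w) (list_encode ps)"
    unfolding accepting_run_def Let_def
    using A w(1) ps
    by (force simp: x automaton_encode_def automaton_over_def nth_default_nth triple_code
        numeral_eq_Suc simp del: list_encode.simps)
  then show ?thesis
    by blast
qed

lemma Sigma01_model_checking_staircase:
  assumes R: "decidable 2 (\<lambda>xs. R (arg 0 xs) (arg 1 xs))"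
  shows "Sigma01 (model_checking {0..3} (staircase R))"
  unfolding Sigma01_def
proof (intro exI conjI)
  show "decidable 2 (\<lambda>xs. accepting_run R (arg 0 xs) (fst (prod_decode (arg 1 xs))) (snd (prod_decode (arg 1 xs))))"
    by (intro computable_intros decidable_accepting_run R) simp_all
  show "model_checking {0..3} (staircase R) = {x. \<exists>y. accepting_run R (arg 0 [x, y])
      (fst (prod_decode (arg 1 [x, y]))) (snd (prod_decode (arg 1 [x, y])))}"
  proof (intro set_eqI iffI)
    fix x assume "x \<in> model_checking {0..3} (staircase R)"
    then obtain u s where "accepting_run R x u s"
      using accepting_run_complete by blast
    then show "x \<in> {x. \<exists>y. accepting_run R (arg 0 [x, y])
      (fst (prod_decode (arg 1 [x, y]))) (snd (prod_decode (arg 1 [x, y])))}"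
      by (auto intro: exI[of _ "prod_encode (u, s)"])
  qed (auto intro: accepting_run_sound)
qed

text \<open>
  An automaton for \<open>0 1^e 2^* 3\<close>. In a state \<open>k \<le> e\<close>, exactly \<open>k\<close> letters 1 are still to be read;
  counting down makes the transition list a primitive recursive function of \<open>e\<close>.
\<close>

definition query :: "nat \<Rightarrow> automaton" where
  "query e = \<lparr>num_states = e + 3, start = e + 1,
    trans = map (\<lambda>k. (Suc k, 1, k)) (rev [0..<e]) @ [(e + 1, 0, e), (0, 2, 0), (0, 3, e + 2)],
    final = [e + 2]\<rparr>"

lemma query_trans: "(p, a, q) \<in> set (trans (query e)) \<longleftrightarrow>
    q < e \<and> p = Suc q \<and> a = 1 \<or> p = e + 1 \<and> a = 0 \<and> q = e \<or> p = 0 \<and> a = 2 \<and> q = 0 \<or>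
    p = 0 \<and> a = 3 \<and> q = e + 2"
  by (auto simp: query_def)

lemma path_query_final: "path (query e) (e + 2) w q \<longleftrightarrow> w = [] \<and> q = e + 2"
  by (cases w) (auto simp: query_trans)

lemma path_query_0: "path (query e) 0 w (e + 2) \<longleftrightarrow> (\<exists>t. w = replicate t 2 @ [3])"
proof (induction w)
  case (Cons a w)
  have "path (query e) 0 (a # w) (e + 2) \<longleftrightarrow> a = 2 \<and> path (query e) 0 w (e + 2) \<or> a = 3 \<and> w = []"
    by (auto simp: query_trans path_query_final[simplified])
  also have "\<dots> \<longleftrightarrow> (\<exists>t. a # w = replicate t 2 @ [3])"
  proof
    assume "a = 2 \<and> path (query e) 0 w (e + 2) \<or> a = 3 \<and> w = []"
    then show "\<exists>t. a # w = replicate t 2 @ [3]"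
      unfolding Cons.IH by (metis append_Cons append_Nil replicate_0 replicate_Suc)
  next
    assume "\<exists>t. a # w = replicate t 2 @ [3]"
    then obtain t where "a # w = replicate t 2 @ [3]" ..
    then show "a = 2 \<and> path (query e) 0 w (e + 2) \<or> a = 3 \<and> w = []"
      unfolding Cons.IH by (cases t) auto
  qed
  finally show ?case .
qed simp

lemma path_query:
  "k \<le> e \<Longrightarrow> path (query e) k w (e + 2) \<longleftrightarrow> (\<exists>t. w = replicate k 1 @ replicate t 2 @ [3])"
proof (induction k arbitrary: w)
  case 0
  then show ?case
    using path_query_0 by simp
next
  case (Suc k)
  show ?case
  proof (cases w)
    case (Cons a v)
    have "path (query e) (Suc k) w (e + 2) \<longleftrightarrow> a = 1 \<and> path (query e) k v (e + 2)"
      using Suc.prems by (auto simp: Cons query_trans)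
    then show ?thesis
      using Suc by (auto simp: Cons)
  qed (use Suc.prems in auto)
qed

lemma recognized_query: "recognized (query e) = {0 # replicate e 1 @ replicate t 2 @ [3] |t. True}"
proof -
  have "path (query e) (e + 1) w (e + 2) \<longleftrightarrow> (\<exists>t. w = 0 # replicate e 1 @ replicate t 2 @ [3])" for w
  proof (cases w)
    case (Cons a v)
    have "path (query e) (e + 1) w (e + 2) \<longleftrightarrow> a = 0 \<and> path (query e) e v (e + 2)"
      by (auto simp: Cons query_trans)
    then show ?thesis
      using path_query[of e e v] by (auto simp: Cons)
  qed simp
  then show ?thesis
    by (auto simp: recognized_def query_def)
qed

lemma admissible_query_word: "admissible R (0 # replicate e 1 @ replicate t 2 @ [3]) \<longleftrightarrow> R e t"
proof -
  define w :: "nat list" where "w = 0 # replicate e 1 @ replicate t 2 @ [3]"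
  have len: "length w = e + t + 2"
    by (simp add: w_def)
  have nth: "w ! i = (if i = 0 then 0 else if i \<le> e then 1 else if i \<le> e + t then 2 else 3)"
    if "i < e + t + 2" for i
    using that by (auto simp: w_def nth_Cons nth_append split: nat.split)
  have steps: "w ! i < 1 \<and> 1 \<le> w ! Suc i \<longleftrightarrow> i = 0" "w ! i < 2 \<and> 2 \<le> w ! Suc i \<longleftrightarrow> i = e"
    "w ! i < 3 \<and> 3 \<le> w ! Suc i \<longleftrightarrow> i = e + t" if "i < e + t + 1" for i
    using that by (auto simp: nth split: if_splits)
  have "admissible R w \<longleftrightarrow> (\<forall>i<e + t + 1. \<forall>j<e + t + 1. \<forall>k<e + t + 1.
      (w ! i < 1 \<and> 1 \<le> w ! Suc i) \<and> (w ! j < 2 \<and> 2 \<le> w ! Suc j) \<and> (w ! k < 3 \<and> 3 \<le> w ! Suc k) \<longrightarrow>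
      R (j - i) (k - j))"
    unfolding admissible_def len by (auto simp: nth)
  also have "\<dots> \<longleftrightarrow> R e t"
    using steps by auto
  finally show ?thesis
    by (simp add: w_def)
qed

lemma query_in_model_checking:
  "automaton_encode (query e) \<in> model_checking {0..3} (staircase R) \<longleftrightarrow> (\<exists>t. R e t)"
proof -
  \<comment> \<open>Model checking is defined on codes, so a code must determine its automaton.\<close>
  have inj: "A = B" if "automaton_encode A = automaton_encode B" for A B
  proof -
    have "inj (\<lambda>(p, a, q). list_encode [p, a, q])"
      by (auto simp: inj_on_def list_encode_eq simp del: list_encode.simps)
    then show ?thesis
      using that unfolding automaton_encode_def list_encode_eq
      by (cases A; cases B) (auto simp: list_encode_eq inj_map_eq_map simp del: list_encode.simps)
  qed
  have "automaton_over {0..3} (query e)"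
    by (auto simp: automaton_over_def query_def)
  then have "automaton_encode (query e) \<in> model_checking {0..3} (staircase R) \<longleftrightarrow>
      language (staircase R) \<inter> recognized (query e) \<noteq> {}"
    unfolding model_checking_def by (auto dest: inj)
  also have "\<dots> \<longleftrightarrow> (\<exists>t. R e t)"
    unfolding language_staircase recognized_query using admissible_query_word[of R e] by blast
  finally show ?thesis .
qed

lemma computable_cons_code [computable_intros]:
  "computable k f \<Longrightarrow> computable k g \<Longrightarrow> computable k (\<lambda>xs. cons_code (f xs) (g xs))"
  unfolding cons_code_def by (intro computable_intros)

lemma list_encode_cons_code:
  "list_encode (n # xs) = cons_code n (list_encode xs)"
  by (simp add: cons_code_def)

text \<open>
  Since \<open>rev [0..<Suc n]\<close> is \<open>n # rev [0..<n]\<close>, the list is built by adding elements at the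
  front, which is what primitive recursion on the code does.
\<close>

lemma list_encode_countdown:
  "list_encode (map f (rev [0..<n]) @ ys) = rec_nat (list_encode ys) (\<lambda>k. cons_code (f k)) n"
  by (induction n) (simp_all add: list_encode_cons_code del: list_encode.simps(2) cons_code_list_encode)

lemma computable_query: "computable 1 (\<lambda>xs. automaton_encode (query (arg 0 xs)))"
proof -
  have "list_encode (map (\<lambda>(p, a, q). list_encode [p, a, q]) (trans (query e))) =
      list_encode (map (\<lambda>k. triple_code (Suc k) 1 k) (rev [0..<e]) @
        [triple_code (e + 1) 0 e, triple_code 0 2 0, triple_code 0 3 (e + 2)])" for e
    by (simp add: query_def triple_code comp_def del: list_encode.simps)
  then have "automaton_encode (query e) =
      cons_code (e + 3) (cons_code (e + 1) (cons_code
        (rec_nat (cons_code (triple_code (e + 1) 0 e) (cons_code (triple_code 0 2 0)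
            (cons_code (triple_code 0 3 (e + 2)) 0)))
          (\<lambda>k y. cons_code (triple_code (Suc k) 1 k) y) e)
        (cons_code (cons_code (e + 2) 0) 0)))" for e
    unfolding automaton_encode_def list_encode_countdown
    by (simp add: query_def list_encode_cons_code del: list_encode.simps(2) cons_code_list_encode)
  then show ?thesis
    unfolding triple_code_def by (simp, intro computable_intros) simp_all
qed

text \<open>
  If \<open>c\<close> is the index of \<open>A\<close>, then \<open>x\<close> is mapped to the automaton that asks for a letter count
  \<open>t\<close> with \<open>R (prod_encode (c, x)) t\<close>.
\<close>

lemma universal_staircase:
  assumes R: "decidable 2 (\<lambda>xs. R (arg 0 xs) (arg 1 xs))"
    and universal: "\<And>A. Sigma01 A \<Longrightarrow> \<exists>c. \<forall>x. x \<in> A \<longleftrightarrow> (\<exists>t. R (prod_encode (c, x)) t)"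
  shows "universal_subshift {0..3} (staircase R)"
  unfolding universal_subshift_def Sigma01_complete_def
proof (intro conjI allI impI)
  show "Sigma01 (model_checking {0..3} (staircase R))"
    by (rule Sigma01_model_checking_staircase[OF R])
next
  fix A assume "Sigma01 A"
  then obtain c where c: "\<And>x. x \<in> A \<longleftrightarrow> (\<exists>t. R (prod_encode (c, x)) t)"
    using universal by blast
  show "many_one_reducible A (model_checking {0..3} (staircase R))"
    unfolding many_one_reducible_def
  proof (intro exI conjI allI)
    have "computable 1 (\<lambda>xs. automaton_encode (query (prod_encode (c, arg 0 xs))))"
      by (intro computable_comp1[OF computable_query] computable_intros) simp
    then show "computable 1 (\<lambda>xs. automaton_encode (query (prod_encode (c, hd xs))))"
      by (simp add: arg_def)
  qed (simp add: c query_in_model_checking)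
qed

theorem proposition1:
  "\<exists>(S :: nat set) (X :: (int \<Rightarrow> nat) set).
     finite S \<and> subshift S X \<and> recursive_subshift X \<and> universal_subshift S X \<and>
     finite {Y. minimal_subsystem S X Y}"
proof (intro exI[of _ "{0..3}"] exI[of _ "staircase halting_certificate"] conjI)
  show "universal_subshift {0..3} (staircase halting_certificate)"
    using decidable_halting_certificate
  proof (rule universal_staircase)
    show "\<exists>c. \<forall>x. x \<in> A \<longleftrightarrow> (\<exists>t. halting_certificate (prod_encode (c, x)) t)"
      if "Sigma01 A" for A
      by (rule halting_certificate_universal[OF that]) blast
  qed
qed (simp_all add: subshift_staircase finite_minimal_subsystems_staircase
    recursive_staircase[OF decidable_halting_certificate])

end
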